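(* The discrete Totalitarian Tug-of-War game (that is, the Totalitarian Tug-of-War played on a finite graph with nonempty set of terminal nodes, with parameter $\epsilon>0$ and terminal payoff $F$) has a value, which is unique. That is, $u^I(x)=u^{II}(x)$ for every node $x$ of the graph, where $u^I$ and $u^{II}$ are the values of the game for Player I and for Player II.
   Context: Game. Let a finite undirected graph be given, its nodes being split into running (interior) nodes and a nonempty set of terminal nodes; let $\epsilon>0$ and let $F$ be a real-valued function on the terminal nodes. All these data are known to both players. A token starts at a node $x^0$. At each turn, with the token at a running node, Player I decides either (i) to play a round of classical random Tug-of-War: a fair coin is tossed and the winner of the toss chooses the new position of the token among the neighbors of the current node; or (ii) to force Player II to choose the new position among the neighbors of the current node, in exchange for a fixed payoff $\epsilon$ to Player I. The game ends the first time $\tau$ that the token reaches a terminal node $x^\tau$; then Player I receives from Player II the total payoff $F_\tau+k_\tau\,\epsilon$, where $F_\tau=F(x^\tau)$ and $k_\tau\in\{0,1,\dots,\tau\}$ is the number of turns at which Player I chose option (ii). Player I wants to maximize and Player II to minimize this quantity. Strategies. The history up to stage $k$ is $H^k=(x^0,a^0,x^1,a^1,\dots,a^{k-1},x^k)$, where $x^i$ is the position at turn $i$ and $a^i$ is the action carried out by the player who moved from $x^i$. A (pure) strategy $S_\alpha=\{S_\alpha^k\}_k$ for player $\alpha\in\{I,II\}$ is a sequence of mappings from histories $H^k$ to actions: at every turn it prescribes the player's action as a function of the past history and current position (for Player I: the choice between (i) and (ii), and the neighbor to move to if the coin toss is won; for Player II: the neighbor to move to if given the move). Values. For strategies $S_I,S_{II}$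 and starting node $x$, let $\mathbb{E}^x_{S_I,S_{II}}[F_\tau+k_\tau\epsilon]$ be the expected payoff. Set $V^x_{S_I,S_{II}}(I)=V^x_{S_I,S_{II}}(II)=\mathbb{E}^x_{S_I,S_{II}}[F_\tau+k_\tau\epsilon]$ if the game ends almost surely, and otherwise $V^x_{S_I,S_{II}}(I)=-\infty$ and $V^x_{S_I,S_{II}}(II)=+\infty$. Define $$u^I(x)=\sup_{S_I}\inf_{S_{II}}V^x_{S_I,S_{II}}(I),\qquad u^{II}(x)=\inf_{S_{II}}\sup_{S_I}V^x_{S_I,S_{II}}(II).$$ The game is said to have a value when $u^I=u^{II}$, and the common function is the value of the game.
   Formalization: It is additionally assumed that every node of the graph is joined by a path to some terminal node; otherwise, at a running node with neighbors but no path to a terminal node, the game never ends, so u^I = −∞ and u^II = +∞. *)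

theory Defs
  imports "HOL-Probability.Probability" "Graph_Theory.Digraph"
begin

text \<open>
  Finite undirected graphs are the \<^locale>\<open>pseudo_graph\<close>s of Graph_Theory: finite symmetric
  digraphs, loops and parallel edges allowed. The neighbors of \<open>x\<close> are the \<open>y\<close> with
  \<open>x \<rightarrow>\<^bsub>G\<^esub> y\<close>. Throughout, \<open>T\<close> is the set of terminal nodes, and the running nodes
  are \<open>verts G - T\<close>.
\<close>

text \<open>
  How a turn was carried out: a round of Tug-of-War won by Player I, a round of Tug-of-War won by
  Player II, or a move imposed on Player II by Player I against the payment \<open>\<epsilon>\<close>.
\<close>
datatype turn = Tug_I | Tug_II | Forced

text \<open>
  \<open>Move h a y\<close> extends the history \<open>h\<close> of the first \<open>k\<close> turns by the action and the new
  position of turn \<open>k\<close>. The neighbor picked by an action is the new position, so the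
  remaining content of the action is which player moved, and under which option.
\<close>
datatype 'a history = Start 'a | Move "'a history" turn 'a

primrec position :: "'a history \<Rightarrow> 'a" where
  "position (Start x) = x"
| "position (Move h a y) = y"

primrec forced_count :: "'a history \<Rightarrow> nat" where
  "forced_count (Start x) = 0"
| "forced_count (Move h a y) = forced_count h + (if a = Forced then 1 else 0)"

text \<open>
  Player I's decision at a running node: \<open>Tug y\<close> is option (i), with \<open>y\<close> the node to move to if
  the toss is won; \<open>Force\<close> is option (ii).
\<close>
datatype 'a decision = Tug 'a | Force

type_synonym 'a strategy_I = "'a history \<Rightarrow> 'a decision"
type_synonym 'a strategy_II = "'a history \<Rightarrow> 'a"

definition strategies_I :: "('a, 'b) pre_digraph \<Rightarrow> 'a set \<Rightarrow> 'a strategy_I set" where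
  "strategies_I G T =
    {S. \<forall>h. position h \<in> verts G - T \<longrightarrow>
          (case S h of Tug y \<Rightarrow> position h \<rightarrow>\<^bsub>G\<^esub> y | Force \<Rightarrow> True)}"

definition strategies_II :: "('a, 'b) pre_digraph \<Rightarrow> 'a set \<Rightarrow> 'a strategy_II set" where
  "strategies_II G T =
    {S. \<forall>h. position h \<in> verts G - T \<longrightarrow> position h \<rightarrow>\<^bsub>G\<^esub> S h}"

text \<open>
  One fair coin per turn, where \<open>\<omega> k\<close> means that Player I wins the toss of turn \<open>k\<close>. The coin
  of a turn at which Player I chooses option (ii) is ignored.
\<close>
definition coin_space :: "(nat \<Rightarrow> bool) measure" where
  "coin_space = (\<Pi>\<^sub>M k\<in>UNIV. measure_pmf (bernoulli_pmf (1/2)))"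

text \<open>
  The history after \<open>k\<close> turns, for given coin tosses; it is frozen once the token has
  reached a terminal node.
\<close>
primrec play :: "'a set \<Rightarrow> 'a strategy_I \<Rightarrow> 'a strategy_II \<Rightarrow> 'a \<Rightarrow> (nat \<Rightarrow> bool) \<Rightarrow> nat \<Rightarrow> 'a history"
where
  "play T S\<^sub>I S\<^sub>I\<^sub>I x \<omega> 0 = Start x"
| "play T S\<^sub>I S\<^sub>I\<^sub>I x \<omega> (Suc k) =
    (let h = play T S\<^sub>I S\<^sub>I\<^sub>I x \<omega> k in
      if position h \<in> T then h
      else case S\<^sub>I h of
        Tug y \<Rightarrow> if \<omega> k then Move h Tug_I y else Move h Tug_II (S\<^sub>I\<^sub>I h)
      | Force \<Rightarrow> Move h Forced (S\<^sub>I\<^sub>I h))"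

definition ends :: "'a set \<Rightarrow> 'a strategy_I \<Rightarrow> 'a strategy_II \<Rightarrow> 'a \<Rightarrow> (nat \<Rightarrow> bool) \<Rightarrow> bool" where
  "ends T S\<^sub>I S\<^sub>I\<^sub>I x \<omega> \<longleftrightarrow> (\<exists>k. position (play T S\<^sub>I S\<^sub>I\<^sub>I x \<omega> k) \<in> T)"

definition end_time :: "'a set \<Rightarrow> 'a strategy_I \<Rightarrow> 'a strategy_II \<Rightarrow> 'a \<Rightarrow> (nat \<Rightarrow> bool) \<Rightarrow> nat" where
  "end_time T S\<^sub>I S\<^sub>I\<^sub>I x \<omega> = (LEAST k. position (play T S\<^sub>I S\<^sub>I\<^sub>I x \<omega> k) \<in> T)"

definition payoff ::
  "'a set \<Rightarrow> real \<Rightarrow> ('a \<Rightarrow> real) \<Rightarrow> 'a strategy_I \<Rightarrow> 'a strategy_II \<Rightarrow> 'a \<Rightarrow> (nat \<Rightarrow> bool) \<Rightarrow> real"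
where
  "payoff T \<epsilon> F S\<^sub>I S\<^sub>I\<^sub>I x \<omega> =
    (let h = play T S\<^sub>I S\<^sub>I\<^sub>I x \<omega> (end_time T S\<^sub>I S\<^sub>I\<^sub>I x \<omega>)
     in F (position h) + real (forced_count h) * \<epsilon>)"

text \<open>
  The expected payoff can be \<open>\<infinity>\<close> even if the game ends almost surely, so it is taken in the
  extended reals, as the integral of the positive part minus that of the negative part
  (\<^const>\<open>ennreal\<close> truncates negative reals to 0). The latter integral is finite for the payoff of an
  almost surely ending game, since \<open>F\<close> is bounded on the finite set of terminal nodes.
\<close>
definition ext_expectation :: "'w measure \<Rightarrow> ('w \<Rightarrow> real) \<Rightarrow> ereal" where
  "ext_expectation M X =
    enn2ereal (\<integral>\<^sup>+\<omega>. ennreal (X \<omega>) \<partial>M) - enn2ereal (\<integral>\<^sup>+\<omega>. ennreal (- X \<omega>) \<partial>M)"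

definition V_I ::
  "'a set \<Rightarrow> real \<Rightarrow> ('a \<Rightarrow> real) \<Rightarrow> 'a strategy_I \<Rightarrow> 'a strategy_II \<Rightarrow> 'a \<Rightarrow> ereal"
where
  "V_I T \<epsilon> F S\<^sub>I S\<^sub>I\<^sub>I x =
    (if AE \<omega> in coin_space. ends T S\<^sub>I S\<^sub>I\<^sub>I x \<omega>
     then ext_expectation coin_space (payoff T \<epsilon> F S\<^sub>I S\<^sub>I\<^sub>I x) else -\<infinity>)"

definition V_II ::
  "'a set \<Rightarrow> real \<Rightarrow> ('a \<Rightarrow> real) \<Rightarrow> 'a strategy_I \<Rightarrow> 'a strategy_II \<Rightarrow> 'a \<Rightarrow> ereal"
where
  "V_II T \<epsilon> F S\<^sub>I S\<^sub>I\<^sub>I x =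
    (if AE \<omega> in coin_space. ends T S\<^sub>I S\<^sub>I\<^sub>I x \<omega>
     then ext_expectation coin_space (payoff T \<epsilon> F S\<^sub>I S\<^sub>I\<^sub>I x) else \<infinity>)"

definition u_I :: "('a, 'b) pre_digraph \<Rightarrow> 'a set \<Rightarrow> real \<Rightarrow> ('a \<Rightarrow> real) \<Rightarrow> 'a \<Rightarrow> ereal" where
  "u_I G T \<epsilon> F x =
    (SUP S\<^sub>I\<in>strategies_I G T. INF S\<^sub>I\<^sub>I\<in>strategies_II G T. V_I T \<epsilon> F S\<^sub>I S\<^sub>I\<^sub>I x)"

definition u_II :: "('a, 'b) pre_digraph \<Rightarrow> 'a set \<Rightarrow> real \<Rightarrow> ('a \<Rightarrow> real) \<Rightarrow> 'a \<Rightarrow> ereal" where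
  "u_II G T \<epsilon> F x =
    (INF S\<^sub>I\<^sub>I\<in>strategies_II G T. SUP S\<^sub>I\<in>strategies_I G T. V_II T \<epsilon> F S\<^sub>I S\<^sub>I\<^sub>I x)"

text \<open>
  Connectivity, as needed for the game to be able to end: every node is linked by a path to some
  terminal node. This holds in particular if the graph is connected and \<open>T\<close> is nonempty. At a node
  that has neighbors but is linked to no terminal node the game never ends, and
  \<open>u_I = -\<infinity>\<close>, \<open>u_II = \<infinity>\<close> there; at an isolated running node there is no legal move.
\<close>
definition terminals_reachable :: "('a, 'b) pre_digraph \<Rightarrow> 'a set \<Rightarrow> bool" where
  "terminals_reachable G T \<longleftrightarrow> (\<forall>x\<in>verts G. \<exists>t\<in>T. x \<rightarrow>\<^sup>*\<^bsub>G\<^esub> t)"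

end

theory Submission
  imports Defs
begin

text \<open>
  A solution \<open>u\<close> of the dynamic programming principle
  \<open>u x = max ((max u + min u) / 2) (min u + \<epsilon>)\<close> (extrema over the neighbors of \<open>x\<close>, and \<open>u = F\<close> on
  \<open>T\<close>) is obtained as the supremum of the subsolutions lying below \<open>max F + \<epsilon> dist(\<cdot>, T)\<close>, which is
  a supersolution.

  Player II always moves to a minimum of \<open>u\<close>. Then \<open>u(position) + \<epsilon> * forced_count\<close> is a
  supermartingale, and the game ends since each of her moves lowers \<open>u\<close> by at least \<open>\<epsilon>\<close>; by Fatou
  \<open>u_II \<le> u\<close>.

  Player I forces when \<open>u x = min u + \<epsilon>\<close> and otherwise tugs toward a maximum of \<open>u\<close>, which then
  raises \<open>u\<close> by more than \<open>\<epsilon>\<close>. Forcing forever might prevent the game from ending, so after \<open>K\<close>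
  forced turns he only tugs toward \<open>T\<close>; by then he has collected \<open>K * \<epsilon>\<close>, and for large \<open>K\<close> this costs
  him arbitrarily little, whence \<open>u \<le> u_I\<close>.
\<close>

section \<open>Processes driven by coin tosses\<close>

primrec run :: "('h \<Rightarrow> bool \<Rightarrow> 'h) \<Rightarrow> 'h \<Rightarrow> (nat \<Rightarrow> bool) \<Rightarrow> nat \<Rightarrow> 'h" where
  "run s h \<omega> 0 = h"
| "run s h \<omega> (Suc k) = s (run s h \<omega> k) (\<omega> k)"

text \<open>\<open>run\<close> recurses on the last toss. Splitting off the first one leaves a run
  of the same process from another state, so inductions over the number of turns can generalise over
  the initial state.\<close>

lemma run_Suc_shift: "run s h \<omega> (Suc k) = run s (s h (\<omega> 0)) (\<lambda>i. \<omega> (Suc i)) k"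
  by (induction k) auto

lemma run_case_nat [simp]: "run s h (case_nat b \<omega>) (Suc k) = run s (s h b) \<omega> k"
  unfolding run_Suc_shift by simp

lemma run_invariant:
  assumes "I h" and "\<And>h b. I h \<Longrightarrow> I (s h b)"
  shows "I (run s h \<omega> k)"
  by (induction k) (auto intro: assms)

section \<open>The coin space and its decomposition by the first toss\<close>

lemma sequence_space_coin: "sequence_space (measure_pmf (bernoulli_pmf (1/2)))"
  by unfold_locales

lemma prob_space_coin_space: "prob_space coin_space"
proof -
  interpret sequence_space "measure_pmf (bernoulli_pmf (1/2))" by (rule sequence_space_coin)
  show ?thesis unfolding coin_space_def by (rule P.prob_space_axioms)
qed

lemma space_coin_space [simp]: "space coin_space = UNIV"
  by (auto simp: coin_space_def space_PiM)

lemma measurable_coin [measurable]: "(\<lambda>\<omega>. \<omega> k) \<in> coin_space \<rightarrow>\<^sub>M count_space UNIV"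
proof -
  have "(\<lambda>\<omega>. \<omega> k) \<in> coin_space \<rightarrow>\<^sub>M measure_pmf (bernoulli_pmf (1/2))"
    unfolding coin_space_def by measurable
  then show ?thesis by simp
qed

lemma measurable_shift: "(\<lambda>\<omega> i. \<omega> (Suc i)) \<in> coin_space \<rightarrow>\<^sub>M coin_space"
  unfolding coin_space_def
proof (rule measurable_PiM_single')
  fix i :: nat
  show "(\<lambda>\<omega>. \<omega> (Suc i)) \<in> (\<Pi>\<^sub>M k\<in>UNIV. measure_pmf (bernoulli_pmf (1/2))) \<rightarrow>\<^sub>M measure_pmf (bernoulli_pmf (1/2))"
    by (rule measurable_component_singleton) simp
qed (auto simp: space_PiM)

text \<open>The state type is arbitrary and carries the discrete sigma-algebra. The first
  \<open>k\<close> tosses select among finitely many states, and the induction branches on the first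
  toss. As a consequence every function of the state is measurable.\<close>

lemma measurable_run [measurable]: "(\<lambda>\<omega>. run s h \<omega> k) \<in> coin_space \<rightarrow>\<^sub>M count_space UNIV"
proof (induction k arbitrary: h)
  case (Suc k)
  have m: "(\<lambda>\<omega>. run s h' (\<lambda>i. \<omega> (Suc i)) k) \<in> coin_space \<rightarrow>\<^sub>M count_space UNIV" for h'
    using measurable_compose[OF measurable_shift Suc.IH] .
  have "(\<lambda>\<omega>. if \<omega> 0 then run s (s h True) (\<lambda>i. \<omega> (Suc i)) k
                     else run s (s h False) (\<lambda>i. \<omega> (Suc i)) k) \<in> coin_space \<rightarrow>\<^sub>M count_space UNIV"
    by (rule measurable_If) (use m in \<open>measurable\<close>)
  also have "(\<lambda>\<omega>. if \<omega> 0 then run s (s h True) (\<lambda>i. \<omega> (Suc i)) k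
                     else run s (s h False) (\<lambda>i. \<omega> (Suc i)) k) = (\<lambda>\<omega>. run s h \<omega> (Suc k))"
    unfolding run_Suc_shift by (auto simp: fun_eq_iff)
  finally show ?case .
qed simp

lemma measurable_fun_run [measurable]: "(\<lambda>\<omega>. g (run s h \<omega> k)) \<in> borel_measurable coin_space"
  using measurable_compose[OF measurable_run, of g] by simp

text \<open>Prepending an independent fair coin to a toss sequence preserves its law, by
  \<open>PiM_iter\<close>; Fubini then averages over the two values of that coin.\<close>

lemma nn_integral_coin_space:
  assumes [measurable]: "f \<in> borel_measurable coin_space"
  shows "(\<integral>\<^sup>+\<omega>. f \<omega> \<partial>coin_space) =
    ((\<integral>\<^sup>+\<omega>. f (case_nat True \<omega>) \<partial>coin_space) + (\<integral>\<^sup>+\<omega>. f (case_nat False \<omega>) \<partial>coin_space)) / 2"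
proof -
  let ?M = "measure_pmf (bernoulli_pmf (1/2))"
  interpret sequence_space ?M by (rule sequence_space_coin)
  have S: "S = coin_space" by (simp add: coin_space_def)
  interpret C: prob_space coin_space by (rule prob_space_coin_space)
  have pm: "(\<lambda>(s, \<omega>). case_nat s \<omega>) \<in> ?M \<Otimes>\<^sub>M coin_space \<rightarrow>\<^sub>M coin_space"
    unfolding coin_space_def by measurable
  have "(\<integral>\<^sup>+\<omega>. f \<omega> \<partial>coin_space) = (\<integral>\<^sup>+\<omega>. f \<omega> \<partial>distr (?M \<Otimes>\<^sub>M S) S (\<lambda>(s, \<omega>). case_nat s \<omega>))"
    unfolding PiM_iter by (simp add: S)
  also have "\<dots> = (\<integral>\<^sup>+p. f (case p of (s, \<omega>) \<Rightarrow> case_nat s \<omega>) \<partial>(?M \<Otimes>\<^sub>M coin_space))"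
    unfolding S by (rule nn_integral_distr[OF pm]) simp
  also have "\<dots> = (\<integral>\<^sup>+b. \<integral>\<^sup>+\<omega>. f (case_nat b \<omega>) \<partial>coin_space \<partial>?M)"
    using C.nn_integral_fst[OF measurable_compose[OF pm assms]] by simp
  also have "\<dots> = (\<integral>\<^sup>+\<omega>. f (case_nat True \<omega>) \<partial>coin_space) * ennreal (1/2)
                + (\<integral>\<^sup>+\<omega>. f (case_nat False \<omega>) \<partial>coin_space) * ennreal (1/2)"
    by (subst nn_integral_measure_pmf_support[of UNIV]) (auto simp: UNIV_bool)
  also have "ennreal (1/2) = inverse 2"
    by simp
  finally show ?thesis
    by (simp add: divide_ennreal_def distrib_right)
qed

section \<open>Supermartingales and hitting times along a run\<close>

text \<open>A supermartingale does not increase in expectation: condition on the first toss and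
  apply the induction hypothesis to both successors. The invariant \<open>I\<close> confines the
  inequality to a closed set of states containing the run.\<close>

lemma nn_integral_run_le:
  fixes f :: "'h \<Rightarrow> ennreal"
  assumes "I h" and closed: "\<And>h b. I h \<Longrightarrow> I (s h b)"
    and super: "\<And>h. I h \<Longrightarrow> f (s h True) + f (s h False) \<le> 2 * f h"
  shows "(\<integral>\<^sup>+\<omega>. f (run s h \<omega> k) \<partial>coin_space) \<le> f h"
  using \<open>I h\<close>
proof (induction k arbitrary: h)
  case 0
  interpret prob_space coin_space by (rule prob_space_coin_space)
  show ?case using emeasure_space_1 by simp
next
  case (Suc k)
  have "(\<integral>\<^sup>+\<omega>. f (run s h \<omega> (Suc k)) \<partial>coin_space) =
      ((\<integral>\<^sup>+\<omega>. f (run s (s h True) \<omega> k) \<partial>coin_space) + (\<integral>\<^sup>+\<omega>. f (run s (s h False) \<omega> k) \<partial>coin_space)) / 2"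
    by (subst nn_integral_coin_space) (simp_all del: run.simps)
  also have "\<dots> \<le> (f (s h True) + f (s h False)) / 2"
    by (intro divide_right_mono_ennreal add_mono Suc.IH closed Suc.prems)
  also have "\<dots> \<le> (2 * f h) / 2"
    by (intro divide_right_mono_ennreal super Suc.prems)
  also have "\<dots> = f h"
    by (simp add: ennreal_mult_divide_eq mult.commute)
  finally show ?case .
qed

lemma prob_run_Suc:
  "measure coin_space {\<omega>. run s h \<omega> (Suc k) \<in> D} =
    (measure coin_space {\<omega>. run s (s h True) \<omega> k \<in> D} + measure coin_space {\<omega>. run s (s h False) \<omega> k \<in> D}) / 2"
proof -
  interpret prob_space coin_space by (rule prob_space_coin_space)
  have e: "(\<integral>\<^sup>+\<omega>. indicator D (run s h \<omega> k) \<partial>coin_space) = ennreal (measure coin_space {\<omega>. run s h \<omega> k \<in> D})" for h k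
  proof -
    have [measurable]: "{\<omega>. run s h \<omega> k \<in> D} \<in> sets coin_space"
      using measurable_sets[OF measurable_run, of D s h k] by (simp add: vimage_def)
    have "(\<integral>\<^sup>+\<omega>. indicator D (run s h \<omega> k) \<partial>coin_space) = (\<integral>\<^sup>+\<omega>. indicator {\<omega>. run s h \<omega> k \<in> D} \<omega> \<partial>coin_space)"
      by (intro nn_integral_cong) (auto simp: indicator_def)
    also have "\<dots> = emeasure coin_space {\<omega>. run s h \<omega> k \<in> D}"
      by (rule nn_integral_indicator) simp
    finally show ?thesis by (simp add: emeasure_eq_measure)
  qed
  have "ennreal (measure coin_space {\<omega>. run s h \<omega> (Suc k) \<in> D}) =
     (ennreal (measure coin_space {\<omega>. run s (s h True) \<omega> k \<in> D})
      + ennreal (measure coin_space {\<omega>. run s (s h False) \<omega> k \<in> D})) / 2"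
    unfolding e[symmetric] by (subst nn_integral_coin_space) (simp_all del: run.simps)
  also have "\<dots> = ennreal ((measure coin_space {\<omega>. run s (s h True) \<omega> k \<in> D} + measure coin_space {\<omega>. run s (s h False) \<omega> k \<in> D}) / 2)"
    by (simp add: divide_ennreal[symmetric] ennreal_plus[symmetric] del: ennreal_plus)
  finally show ?thesis by (simp add: divide_nonneg_nonneg)
qed

text \<open>The fixed outcome \<open>b\<close> of the toss lowers the bounded rank \<open>r\<close>
  outside \<open>D\<close>, so a long enough streak of that outcome leads into \<open>D\<close>.
  Quantitatively, the probability of being outside \<open>D\<close> at time \<open>n\<close> is at
  most a constant over \<open>n\<close>.\<close>

lemma AE_run_hits:
  fixes r :: "'h \<Rightarrow> nat"
  assumes "I h" and closed: "\<And>h c. I h \<Longrightarrow> I (s h c)"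
    and stay: "\<And>h c. h \<in> D \<Longrightarrow> s h c = h"
    and bound: "\<And>h. I h \<Longrightarrow> r h \<le> L"
    and decr: "\<And>h. I h \<Longrightarrow> h \<notin> D \<Longrightarrow> r (s h b) < r h"
  shows "AE \<omega> in coin_space. \<exists>k. run s h \<omega> k \<in> D"
proof -
  interpret prob_space coin_space by (rule prob_space_coin_space)
  txt \<open>
    A potential with expected decrease at least 1 per turn, in the worst case where the good coin
    lowers \<open>r\<close> by one and the bad coin raises it to \<open>L\<close>.
  \<close>
  define \<Phi> :: "'h \<Rightarrow> real" where "\<Phi> h = (if h \<in> D then 0 else 2 ^ (L + 2) - 2 ^ (L + 1 - r h))" for h
  have \<Phi>_le: "\<Phi> h \<le> 2 ^ (L + 2) - 2 ^ j" if "j \<le> L + 1 - r h" for h j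
  proof (cases "h \<in> D")
    case True
    have "(2::real) ^ j \<le> 2 ^ (L + 2)" using that by (intro power_increasing) auto
    then show ?thesis using True by (simp add: \<Phi>_def)
  next
    case False
    have "(2::real) ^ j \<le> 2 ^ (L + 1 - r h)" using that by (intro power_increasing) auto
    then show ?thesis using False by (simp add: \<Phi>_def)
  qed
  \<comment> \<open>The bound after the good toss subtracts twice the power occurring in
    \<open>\<Phi> h\<close>; the bound after the bad toss still subtracts 2, because
    \<open>r\<close> never exceeds \<open>L\<close>.\<close>
  have drop: "\<Phi> (s h True) + \<Phi> (s h False) \<le> 2 * \<Phi> h - 2" if h: "I h" "h \<notin> D" for h
  proof -
    have "\<Phi> (s h b) \<le> 2 ^ (L + 2) - 2 ^ Suc (L + 1 - r h)"
      using decr[OF h] bound[OF h(1)] by (intro \<Phi>_le) auto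
    moreover have "\<Phi> (s h (\<not> b)) \<le> 2 ^ (L + 2) - 2 ^ 1"
      using bound[OF closed[OF h(1)], of "\<not> b"] by (intro \<Phi>_le) auto
    ultimately have "\<Phi> (s h b) + \<Phi> (s h (\<not> b)) \<le> 2 * \<Phi> h - 2"
      using h(2) by (simp add: \<Phi>_def)
    then show ?thesis by (cases b) auto
  qed
  \<comment> \<open>Induction on \<open>n\<close>: the decrease by 2 over both successors pays for
    the additional term \<open>2 * prob\<close>, which is at most 2. From a state of
    \<open>D\<close> the run never moves.\<close>
  have prob_le: "real n * prob {\<omega>. run s h \<omega> n \<in> - D} \<le> \<Phi> h" if "I h" for h n
    using that
  proof (induction n arbitrary: h)
    case 0
    have "(2::real) ^ (L + 1 - r h) \<le> 2 ^ (L + 2)" by (intro power_increasing) auto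
    then show ?case by (simp add: \<Phi>_def)
  next
    case (Suc n)
    show ?case
    proof (cases "h \<in> D")
      case True
      then have "run s h \<omega> k = h" for \<omega> k by (induction k) (auto simp: stay)
      then show ?thesis using True by (simp add: \<Phi>_def del: run.simps)
    next
      case False
      have "2 * (real (Suc n) * prob {\<omega>. run s h \<omega> (Suc n) \<in> - D}) =
          2 * prob {\<omega>. run s h \<omega> (Suc n) \<in> - D} + real n * prob {\<omega>. run s (s h True) \<omega> n \<in> - D}
          + real n * prob {\<omega>. run s (s h False) \<omega> n \<in> - D}"
        unfolding prob_run_Suc by (simp add: field_simps)
      also have "\<dots> \<le> 2 * 1 + \<Phi> (s h True) + \<Phi> (s h False)"
        by (intro add_mono mult_left_mono Suc.IH closed Suc.prems) auto
      also have "\<dots> \<le> 2 * \<Phi> h" using drop[OF Suc.prems False] by simp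
      finally show ?thesis by simp
    qed
  qed
  define N where "N = {\<omega>. \<forall>k. run s h \<omega> k \<notin> D}"
  have m [measurable]: "{\<omega>. run s h \<omega> k \<in> E} \<in> sets coin_space" for k E
    using measurable_sets[OF measurable_run, of E s h k] by (simp add: vimage_def)
  have N_eq: "N = (\<Inter>k. {\<omega>. run s h \<omega> k \<in> - D})" by (auto simp: N_def)
  have N: "N \<in> sets coin_space"
    unfolding N_eq by (intro sets.countable_INT) (use m[of _ "- D"] in auto)
  have "real n * prob N \<le> \<Phi> h" for n
  proof -
    have "prob N \<le> prob {\<omega>. run s h \<omega> n \<in> - D}"
      by (intro finite_measure_mono m) (auto simp: N_def)
    then have "real n * prob N \<le> real n * prob {\<omega>. run s h \<omega> n \<in> - D}"
      by (intro mult_left_mono) auto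
    then show ?thesis using prob_le[OF \<open>I h\<close>, of n] by linarith
  qed
  then have "\<not> 0 < prob N"
    using reals_Archimedean3[of "prob N"] by (metis not_less)
  then have "prob N = 0"
    using measure_nonneg[of coin_space N] by linarith
  then have "N \<in> null_sets coin_space"
    using N by (auto intro!: null_setsI simp: emeasure_eq_measure)
  then show ?thesis
    by (rule AE_I') (auto simp: N_def)
qed

text \<open>Optional stopping for a supermartingale bounded below, with the stopping time hidden in
  the assumption that \<open>f\<close> along the run is eventually equal to \<open>X\<close>. Thus
  \<open>X + C\<close> is almost surely the liminf of the nonnegative functions
  \<open>f + C\<close>, and Fatou's lemma yields both integrability and the bound.\<close>

lemma integral_run_limit_le:
  fixes f :: "'h \<Rightarrow> real"
  assumes "I h" and closed: "\<And>h b. I h \<Longrightarrow> I (s h b)"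
    and bound: "\<And>h. I h \<Longrightarrow> - C \<le> f h"
    and super: "\<And>h. I h \<Longrightarrow> f (s h True) + f (s h False) \<le> 2 * f h"
    and X [measurable]: "X \<in> borel_measurable coin_space"
    and lim: "AE \<omega> in coin_space. \<exists>k. \<forall>n\<ge>k. f (run s h \<omega> n) = X \<omega>"
  shows "integrable coin_space X" and "integral\<^sup>L coin_space X \<le> f h"
proof -
  interpret prob_space coin_space by (rule prob_space_coin_space)
  have Irun: "I (run s h \<omega> n)" for \<omega> n
    by (rule run_invariant) (auto intro: \<open>I h\<close> closed)
  have X_ge: "AE \<omega> in coin_space. 0 \<le> X \<omega> + C"
    using lim
  proof eventually_elim
    case (elim \<omega>)
    then obtain k where "f (run s h \<omega> k) = X \<omega>" by auto
    then show ?case using bound[OF Irun, of \<omega> k] by simp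
  qed
  have step: "(\<integral>\<^sup>+\<omega>. ennreal (f (run s h \<omega> k) + C) \<partial>coin_space) \<le> ennreal (f h + C)" for k
  proof (rule nn_integral_run_le[where I=I])
    fix h assume h: "I h"
    have "0 \<le> f (s h True) + C" "0 \<le> f (s h False) + C" "0 \<le> f h + C"
      using bound[OF closed[OF h], of True] bound[OF closed[OF h], of False] bound[OF h] by auto
    then show "ennreal (f (s h True) + C) + ennreal (f (s h False) + C) \<le> 2 * ennreal (f h + C)"
      using super[OF h] by (simp add: ennreal_plus[symmetric] ennreal_numeral[symmetric] ennreal_mult[symmetric]
        ennreal_leI del: ennreal_plus ennreal_numeral)
  qed (auto intro: \<open>I h\<close> closed)
  have "(\<integral>\<^sup>+\<omega>. ennreal (X \<omega> + C) \<partial>coin_space)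
      = (\<integral>\<^sup>+\<omega>. liminf (\<lambda>n. ennreal (f (run s h \<omega> n) + C)) \<partial>coin_space)"
  proof (rule nn_integral_cong_AE)
    show "AE \<omega> in coin_space. ennreal (X \<omega> + C) = liminf (\<lambda>n. ennreal (f (run s h \<omega> n) + C))"
      using lim
    proof eventually_elim
      case (elim \<omega>)
      then have "eventually (\<lambda>n. ennreal (f (run s h \<omega> n) + C) = ennreal (X \<omega> + C)) sequentially"
        unfolding eventually_sequentially by (elim ex_forward) simp
      then have "liminf (\<lambda>n. ennreal (f (run s h \<omega> n) + C)) = liminf (\<lambda>n::nat. ennreal (X \<omega> + C))"
        by (rule Liminf_eq)
      then show ?case by (simp add: Liminf_const)
    qed
  qed
  also have "\<dots> \<le> liminf (\<lambda>n. \<integral>\<^sup>+\<omega>. ennreal (f (run s h \<omega> n) + C) \<partial>coin_space)"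
    by (rule nn_integral_liminf) simp
  also have "\<dots> \<le> liminf (\<lambda>n::nat. ennreal (f h + C))"
    by (intro Liminf_mono always_eventually allI step)
  also have "\<dots> = ennreal (f h + C)" by (simp add: Liminf_const)
  finally have le: "(\<integral>\<^sup>+\<omega>. ennreal (X \<omega> + C) \<partial>coin_space) \<le> ennreal (f h + C)" .
  have i: "integrable coin_space (\<lambda>\<omega>. X \<omega> + C)"
    by (rule integrableI_nonneg) (use X_ge le in \<open>auto intro: le_less_trans\<close>)
  from Bochner_Integration.integrable_diff[OF i integrable_const[of C]]
  show iX: "integrable coin_space X" by simp
  have "ennreal (integral\<^sup>L coin_space (\<lambda>\<omega>. X \<omega> + C)) \<le> ennreal (f h + C)"
    using le nn_integral_eq_integral[OF i X_ge] by simp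
  moreover have "0 \<le> f h + C" using bound[OF \<open>I h\<close>] by simp
  ultimately have "integral\<^sup>L coin_space (\<lambda>\<omega>. X \<omega> + C) \<le> f h + C" by simp
  then show "integral\<^sup>L coin_space X \<le> f h"
    using iX prob_space by simp
qed

lemma ext_expectation_integrable:
  assumes "integrable M X"
  shows "ext_expectation M X = ereal (integral\<^sup>L M X)"
proof -
  have "(\<integral>\<^sup>+\<omega>. ennreal (X \<omega>) \<partial>M) \<noteq> \<infinity>" "(\<integral>\<^sup>+\<omega>. ennreal (- X \<omega>) \<partial>M) \<noteq> \<infinity>"
    using assms by (auto simp: real_integrable_def)
  then show ?thesis
    unfolding ext_expectation_def real_lebesgue_integral_def[OF assms]
    by (cases "\<integral>\<^sup>+\<omega>. ennreal (X \<omega>) \<partial>M"; cases "\<integral>\<^sup>+\<omega>. ennreal (- X \<omega>) \<partial>M") auto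
qed

section \<open>Plays of the game\<close>

text \<open>One turn with its coin as an argument, in the shape that \<open>run\<close>
  expects.\<close>

definition next_history ::
  "'a set \<Rightarrow> 'a strategy_I \<Rightarrow> 'a strategy_II \<Rightarrow> 'a history \<Rightarrow> bool \<Rightarrow> 'a history" where
  "next_history T S\<^sub>I S\<^sub>I\<^sub>I h b =
    (if position h \<in> T then h
     else case S\<^sub>I h of
       Tug y \<Rightarrow> if b then Move h Tug_I y else Move h Tug_II (S\<^sub>I\<^sub>I h)
     | Force \<Rightarrow> Move h Forced (S\<^sub>I\<^sub>I h))"

lemma play_Suc: "play T S\<^sub>I S\<^sub>I\<^sub>I x \<omega> (Suc k) = next_history T S\<^sub>I S\<^sub>I\<^sub>I (play T S\<^sub>I S\<^sub>I\<^sub>I x \<omega> k) (\<omega> k)"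
  by (simp only: play.simps Let_def next_history_def)

lemma play_eq_run: "play T S\<^sub>I S\<^sub>I\<^sub>I x \<omega> k = run (next_history T S\<^sub>I S\<^sub>I\<^sub>I) (Start x) \<omega> k"
  by (induction k) (simp_all only: play_Suc play.simps(1) run.simps)

lemma measurable_play [measurable]:
  "(\<lambda>\<omega>. play T S\<^sub>I S\<^sub>I\<^sub>I x \<omega> k) \<in> coin_space \<rightarrow>\<^sub>M count_space UNIV"
  unfolding play_eq_run by (rule measurable_run)

text \<open>The payoff reads the play at the random index \<open>end_time\<close>, which takes
  countably many values, so measurability at each fixed index is enough.\<close>

lemma payoff_measurable: "payoff T \<epsilon> F S\<^sub>I S\<^sub>I\<^sub>I x \<in> borel_measurable coin_space"
proof -
  have "(\<lambda>\<omega>. end_time T S\<^sub>I S\<^sub>I\<^sub>I x \<omega>) \<in> coin_space \<rightarrow>\<^sub>M count_space UNIV"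
    unfolding end_time_def
  proof (rule measurable_Least)
    fix k
    have "(\<lambda>h. position h \<in> T) \<in> count_space UNIV \<rightarrow>\<^sub>M count_space UNIV" by simp
    then show "(\<lambda>\<omega>. position (play T S\<^sub>I S\<^sub>I\<^sub>I x \<omega> k) \<in> T) \<in> coin_space \<rightarrow>\<^sub>M count_space UNIV"
      by (rule measurable_compose[OF measurable_play])
  qed
  moreover have "(\<lambda>\<omega>. F (position (play T S\<^sub>I S\<^sub>I\<^sub>I x \<omega> k)) + real (forced_count (play T S\<^sub>I S\<^sub>I\<^sub>I x \<omega> k)) * \<epsilon>)
      \<in> borel_measurable coin_space" for k
  proof -
    have "(\<lambda>h. F (position h) + real (forced_count h) * \<epsilon>) \<in> count_space UNIV \<rightarrow>\<^sub>M borel" by simp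
    then show ?thesis by (rule measurable_compose[OF measurable_play])
  qed
  ultimately have "(\<lambda>\<omega>. F (position (play T S\<^sub>I S\<^sub>I\<^sub>I x \<omega> (end_time T S\<^sub>I S\<^sub>I\<^sub>I x \<omega>)))
      + real (forced_count (play T S\<^sub>I S\<^sub>I\<^sub>I x \<omega> (end_time T S\<^sub>I S\<^sub>I\<^sub>I x \<omega>))) * \<epsilon>) \<in> borel_measurable coin_space"
    by (rule measurable_compose_countable[rotated])
  then show ?thesis by (simp add: payoff_def[abs_def] Let_def)
qed

lemma play_after_end:
  assumes "ends T S\<^sub>I S\<^sub>I\<^sub>I x \<omega>" and "n \<ge> end_time T S\<^sub>I S\<^sub>I\<^sub>I x \<omega>"
  shows "play T S\<^sub>I S\<^sub>I\<^sub>I x \<omega> n = play T S\<^sub>I S\<^sub>I\<^sub>I x \<omega> (end_time T S\<^sub>I S\<^sub>I\<^sub>I x \<omega>)"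
    and "position (play T S\<^sub>I S\<^sub>I\<^sub>I x \<omega> n) \<in> T"
proof -
  have fin: "position (play T S\<^sub>I S\<^sub>I\<^sub>I x \<omega> (end_time T S\<^sub>I S\<^sub>I\<^sub>I x \<omega>)) \<in> T"
    using assms(1) unfolding ends_def end_time_def by (rule LeastI_ex)
  show 1: "play T S\<^sub>I S\<^sub>I\<^sub>I x \<omega> n = play T S\<^sub>I S\<^sub>I\<^sub>I x \<omega> (end_time T S\<^sub>I S\<^sub>I\<^sub>I x \<omega>)"
    using assms(2)
  proof (induction n rule: dec_induct)
    case (step n)
    then show ?case using fin by simp
  qed simp
  show "position (play T S\<^sub>I S\<^sub>I\<^sub>I x \<omega> n) \<in> T" using fin by (simp add: 1)
qed

text \<open>\<open>f\<close> assigns a value to each history and is exact on finished ones; the play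
  is frozen from \<open>end_time\<close> on.\<close>

lemma eventually_payoff:
  assumes "ends T S\<^sub>I S\<^sub>I\<^sub>I x \<omega>"
    and I: "I (Start x)" "\<And>h b. I h \<Longrightarrow> I (next_history T S\<^sub>I S\<^sub>I\<^sub>I h b)"
    and final: "\<And>h. I h \<Longrightarrow> position h \<in> T \<Longrightarrow> f h = F (position h) + real (forced_count h) * \<epsilon>"
  shows "\<exists>k. \<forall>n\<ge>k. f (run (next_history T S\<^sub>I S\<^sub>I\<^sub>I) (Start x) \<omega> n) = payoff T \<epsilon> F S\<^sub>I S\<^sub>I\<^sub>I x \<omega>"
proof (intro exI allI impI)
  fix n assume n: "n \<ge> end_time T S\<^sub>I S\<^sub>I\<^sub>I x \<omega>"
  have "I (run (next_history T S\<^sub>I S\<^sub>I\<^sub>I) (Start x) \<omega> n)"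
    by (rule run_invariant) (fact I)+
  then have "f (run (next_history T S\<^sub>I S\<^sub>I\<^sub>I) (Start x) \<omega> n) =
      F (position (play T S\<^sub>I S\<^sub>I\<^sub>I x \<omega> n)) + real (forced_count (play T S\<^sub>I S\<^sub>I\<^sub>I x \<omega> n)) * \<epsilon>"
    using play_after_end(2)[OF assms(1) n] final unfolding play_eq_run by blast
  then show "f (run (next_history T S\<^sub>I S\<^sub>I\<^sub>I) (Start x) \<omega> n) = payoff T \<epsilon> F S\<^sub>I S\<^sub>I\<^sub>I x \<omega>"
    unfolding payoff_def Let_def play_after_end(1)[OF assms(1) n] .
qed

text \<open>Verification of an upper bound: \<open>f\<close> is a supermartingale bounded below
  whose final values are the payoffs, so its initial value dominates the expected payoff.\<close>

lemma expected_payoff_le: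
  assumes ends: "AE \<omega> in coin_space. ends T S\<^sub>I S\<^sub>I\<^sub>I x \<omega>"
    and I: "I (Start x)" "\<And>h b. I h \<Longrightarrow> I (next_history T S\<^sub>I S\<^sub>I\<^sub>I h b)"
    and final: "\<And>h. I h \<Longrightarrow> position h \<in> T \<Longrightarrow> f h = F (position h) + real (forced_count h) * \<epsilon>"
    and bound: "\<And>h. I h \<Longrightarrow> C \<le> f h"
    and super: "\<And>h. I h \<Longrightarrow> position h \<notin> T \<Longrightarrow>
      f (next_history T S\<^sub>I S\<^sub>I\<^sub>I h True) + f (next_history T S\<^sub>I S\<^sub>I\<^sub>I h False) \<le> 2 * f h"
  shows "ext_expectation coin_space (payoff T \<epsilon> F S\<^sub>I S\<^sub>I\<^sub>I x) \<le> ereal (f (Start x))"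
proof -
  \<comment> \<open>At a terminal position both successors are \<open>h\<close> itself, and equality
    holds.\<close>
  have super': "f (next_history T S\<^sub>I S\<^sub>I\<^sub>I h True) + f (next_history T S\<^sub>I S\<^sub>I\<^sub>I h False) \<le> 2 * f h" if "I h" for h
    using super[OF that] by (cases "position h \<in> T") (simp_all add: next_history_def)
  have "AE \<omega> in coin_space. \<exists>k. \<forall>n\<ge>k.
      f (run (next_history T S\<^sub>I S\<^sub>I\<^sub>I) (Start x) \<omega> n) = payoff T \<epsilon> F S\<^sub>I S\<^sub>I\<^sub>I x \<omega>"
    using ends 
  proof eventually_elim
    case (elim \<omega>)
    show ?case by (rule eventually_payoff[where I=I, OF elim I final])
  qed
  note lim = integral_run_limit_le[where I=I and C="- C", OF I(1,2) _ super' payoff_measurable this]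
  show ?thesis
    using lim bound by (simp add: ext_expectation_integrable)
qed

text \<open>Verification of a lower bound, by applying \<open>integral_run_limit_le\<close> to
  \<open>- f\<close>. The upper bound on \<open>f\<close> makes the payoff integrable, so that its
  extended expectation is an ordinary integral.\<close>

lemma expected_payoff_ge:
  assumes ends: "AE \<omega> in coin_space. ends T S\<^sub>I S\<^sub>I\<^sub>I x \<omega>"
    and I: "I (Start x)" "\<And>h b. I h \<Longrightarrow> I (next_history T S\<^sub>I S\<^sub>I\<^sub>I h b)"
    and final: "\<And>h. I h \<Longrightarrow> position h \<in> T \<Longrightarrow> f h = F (position h) + real (forced_count h) * \<epsilon>"
    and bound: "\<And>h. I h \<Longrightarrow> f h \<le> C"
    and sub: "\<And>h. I h \<Longrightarrow> position h \<notin> T \<Longrightarrow>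
      2 * f h \<le> f (next_history T S\<^sub>I S\<^sub>I\<^sub>I h True) + f (next_history T S\<^sub>I S\<^sub>I\<^sub>I h False)"
  shows "ereal (f (Start x)) \<le> ext_expectation coin_space (payoff T \<epsilon> F S\<^sub>I S\<^sub>I\<^sub>I x)"
proof -
  let ?X = "payoff T \<epsilon> F S\<^sub>I S\<^sub>I\<^sub>I x"
  have sub': "- f (next_history T S\<^sub>I S\<^sub>I\<^sub>I h True) + - f (next_history T S\<^sub>I S\<^sub>I\<^sub>I h False) \<le> 2 * (- f h)" if "I h" for h
    using sub[OF that] by (cases "position h \<in> T") (simp_all add: next_history_def)
  have "AE \<omega> in coin_space. \<exists>k. \<forall>n\<ge>k. f (run (next_history T S\<^sub>I S\<^sub>I\<^sub>I) (Start x) \<omega> n) = ?X \<omega>"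
    using ends 
  proof eventually_elim
    case (elim \<omega>)
    show ?case by (rule eventually_payoff[where I=I, OF elim I final])
  qed
  then have ev: "AE \<omega> in coin_space. \<exists>k. \<forall>n\<ge>k. - f (run (next_history T S\<^sub>I S\<^sub>I\<^sub>I) (Start x) \<omega> n) = - ?X \<omega>"
    by simp
  have m: "(\<lambda>\<omega>. - ?X \<omega>) \<in> borel_measurable coin_space"
    using payoff_measurable by (rule borel_measurable_uminus)
  note lim = integral_run_limit_le[where I=I and C=C and f="\<lambda>h. - f h", OF I(1,2) _ sub' m ev]
  have "integrable coin_space (\<lambda>\<omega>. - ?X \<omega>)" "integral\<^sup>L coin_space (\<lambda>\<omega>. - ?X \<omega>) \<le> - f (Start x)"
    using lim bound by simp_all
  moreover from this(1) have "integrable coin_space ?X" by simp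
  ultimately show ?thesis by (simp add: ext_expectation_integrable)
qed

lemma AE_ends:
  fixes r :: "'a history \<Rightarrow> nat"
  assumes I: "I (Start x)" "\<And>h b. I h \<Longrightarrow> I (next_history T S\<^sub>I S\<^sub>I\<^sub>I h b)"
    and bound: "\<And>h. I h \<Longrightarrow> r h \<le> L"
    and decr: "\<And>h. I h \<Longrightarrow> position h \<notin> T \<Longrightarrow> r (next_history T S\<^sub>I S\<^sub>I\<^sub>I h b) < r h"
  shows "AE \<omega> in coin_space. ends T S\<^sub>I S\<^sub>I\<^sub>I x \<omega>"
proof -
  have "AE \<omega> in coin_space. \<exists>k. run (next_history T S\<^sub>I S\<^sub>I\<^sub>I) (Start x) \<omega> k \<in> {h. position h \<in> T}"
    by (rule AE_run_hits[where I=I and r=r and L=L and b=b])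
       (use assms in \<open>auto simp: next_history_def\<close>)
  then show ?thesis by (simp add: ends_def play_eq_run)
qed

section \<open>The dynamic programming principle\<close>

locale totalitarian_tug_of_war = pseudo_graph G for G :: "('a, 'b) pre_digraph" +
  fixes T :: "'a set" and \<epsilon> :: real and F :: "'a \<Rightarrow> real"
  assumes terminals: "T \<subseteq> verts G" "T \<noteq> {}"
    and reachable: "terminals_reachable G T"
    and \<epsilon>_pos: "\<epsilon> > 0"
begin

lemma next_history_in_verts:
  assumes "S\<^sub>I \<in> strategies_I G T" "S\<^sub>I\<^sub>I \<in> strategies_II G T" and "position h \<in> verts G"
  shows "position (next_history T S\<^sub>I S\<^sub>I\<^sub>I h b) \<in> verts G"
proof (cases "position h \<in> T")
  case False
  then have "case S\<^sub>I h of Tug y \<Rightarrow> position h \<rightarrow>\<^bsub>G\<^esub> y | Force \<Rightarrow> True" "position h \<rightarrow>\<^bsub>G\<^esub> S\<^sub>I\<^sub>I h"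
    using assms unfolding strategies_I_def strategies_II_def by blast+
  then show ?thesis
    using False by (auto simp: next_history_def adj_in_verts split: decision.splits)
qed (use assms in \<open>simp add: next_history_def\<close>)

text \<open>\<open>d\<close> is the length of a shortest walk to \<open>T\<close>. The first
  property follows such a walk for one step; the second reverses the arc, since a walk from
  \<open>y\<close> may first go back to \<open>x\<close>.\<close>

lemma exists_distance:
  obtains d :: "'a \<Rightarrow> nat"
  where "\<And>x. x \<in> verts G - T \<Longrightarrow> \<exists>y. x \<rightarrow>\<^bsub>G\<^esub> y \<and> d y < d x"
    and "\<And>x y. x \<in> verts G \<Longrightarrow> x \<rightarrow>\<^bsub>G\<^esub> y \<Longrightarrow> d y \<le> Suc (d x)"
proof -
  define P where "P x n \<longleftrightarrow> (\<exists>t\<in>T. (x, t) \<in> arcs_ends G ^^ n)" for x n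
  define d where "d x = (LEAST n. P x n)" for x
  have P: "P x (d x)" if "x \<in> verts G" for x
  proof -
    obtain t where "t \<in> T" "x \<rightarrow>\<^sup>*\<^bsub>G\<^esub> t"
      using reachable \<open>x \<in> verts G\<close> unfolding terminals_reachable_def by blast
    then have "(x, t) \<in> (arcs_ends G)\<^sup>*"
      unfolding reachable_def by (blast dest: rtrancl_on_rtranclI)
    then have "\<exists>n. P x n" using \<open>t \<in> T\<close> unfolding P_def rtrancl_power by blast
    then show ?thesis unfolding d_def by (rule LeastI_ex)
  qed
  have d_le: "d x \<le> n" if "P x n" for x n
    unfolding d_def using that by (rule Least_le)
  show ?thesis
  proof
    fix x assume x: "x \<in> verts G - T"
    obtain t where t: "t \<in> T" "(x, t) \<in> arcs_ends G ^^ d x"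
      using P x unfolding P_def by blast
    then obtain n where n: "d x = Suc n" using x by (cases "d x") auto
    then obtain y where "x \<rightarrow>\<^bsub>G\<^esub> y" "(y, t) \<in> arcs_ends G ^^ n"
      using t by (metis relpow_Suc_D2)
    then show "\<exists>y. x \<rightarrow>\<^bsub>G\<^esub> y \<and> d y < d x"
      using d_le[of y n] t(1) n unfolding P_def by (auto simp: less_Suc_eq_le)
  next
    fix x y assume "x \<in> verts G" and xy: "x \<rightarrow>\<^bsub>G\<^esub> y"
    then obtain t where t: "t \<in> T" "(x, t) \<in> arcs_ends G ^^ d x"
      using P unfolding P_def by blast
    have "y \<rightarrow>\<^bsub>G\<^esub> x" using xy sym_arcs by (simp add: arcs_ends_symmetric)
    then have "(y, t) \<in> arcs_ends G ^^ Suc (d x)" using t(2) by (rule relpow_Suc_I2)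
    then show "d y \<le> Suc (d x)" using t(1) by (intro d_le) (auto simp: P_def)
  qed
qed

abbreviation nbrs :: "'a \<Rightarrow> 'a set" where "nbrs x \<equiv> {y. x \<rightarrow>\<^bsub>G\<^esub> y}"

lemma nbrs_subset: "nbrs x \<subseteq> verts G"
  by (auto intro: adj_in_verts)

lemma finite_nbrs: "finite (nbrs x)"
  using nbrs_subset finite_verts by (rule finite_subset)

lemma nbrs_nonempty: "x \<in> verts G - T \<Longrightarrow> nbrs x \<noteq> {}"
  using exists_distance by (metis (no_types, lifting) empty_iff mem_Collect_eq)

section \<open>The dynamic programming equation and its solution\<close>

text \<open>The worth of a node when one turn is played optimally and \<open>u\<close> values the
  next position: the better of a Tug-of-War round and a forced move. Terminal nodes return
  \<open>F\<close>, so a fixed point has the right boundary values.\<close>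

definition dpp :: "('a \<Rightarrow> real) \<Rightarrow> 'a \<Rightarrow> real" where
  "dpp u x = (if x \<in> T then F x
    else max ((Max (u ` nbrs x) + Min (u ` nbrs x)) / 2) (Min (u ` nbrs x) + \<epsilon>))"

lemma dpp_mono:
  assumes le: "\<And>y. y \<in> verts G \<Longrightarrow> v y \<le> w y" and "x \<in> verts G"
  shows "dpp v x \<le> dpp w x"
proof (cases "x \<in> T")
  case False
  note ne = nbrs_nonempty[of x] and [simp] = finite_nbrs
  have le': "v y \<le> w y" if "y \<in> nbrs x" for y
    using le nbrs_subset that by blast
  have max: "Max (v ` nbrs x) \<le> Max (w ` nbrs x)"
  proof (rule Max.boundedI)
    fix a assume "a \<in> v ` nbrs x"
    then obtain y where "y \<in> nbrs x" "a = v y" by blast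
    then show "a \<le> Max (w ` nbrs x)"
      using order_trans[OF le' Max_ge[of "w ` nbrs x" "w y"]] by simp
  qed (use ne assms False in auto)
  have min: "Min (v ` nbrs x) \<le> Min (w ` nbrs x)"
  proof (rule Min.boundedI)
    fix a assume "a \<in> w ` nbrs x"
    then obtain y where "y \<in> nbrs x" "a = w y" by blast
    then show "Min (v ` nbrs x) \<le> a"
      using order_trans[OF Min_le[of "v ` nbrs x" "v y"] le'] by simp
  qed (use ne assms False in auto)
  show ?thesis
    unfolding dpp_def if_not_P[OF False]
    by (intro max.mono divide_right_mono add_mono max min) simp_all
qed (simp add: dpp_def)

text \<open>Knaster-Tarski on the functions between \<open>m\<close> and \<open>w\<close>. On
  \<open>verts G\<close> the supremum \<open>u\<close> of the subsolutions satisfies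
  \<open>u \<le> dpp u\<close> by monotonicity; hence \<open>dpp u\<close> is itself an admissible
  subsolution and lies below \<open>u\<close>.\<close>

lemma exists_dpp_solution: "\<exists>u. \<forall>x\<in>verts G. u x = dpp u x"
proof -
  obtain d :: "'a \<Rightarrow> nat"
    where d_dec: "\<And>x. x \<in> verts G - T \<Longrightarrow> \<exists>y. x \<rightarrow>\<^bsub>G\<^esub> y \<and> d y < d x"
      and d_inc: "\<And>x y. x \<in> verts G \<Longrightarrow> x \<rightarrow>\<^bsub>G\<^esub> y \<Longrightarrow> d y \<le> Suc (d x)"
    using exists_distance by blast
  define m where "m = Min (F ` T)"
  define w where "w x = Max (F ` T) + \<epsilon> * real (d x)" for x
  note [simp] = finite_nbrs
  have finT: "finite T" using terminals finite_verts by (blast intro: finite_subset)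
  have F_bounds: "m \<le> F t" "F t \<le> Max (F ` T)" if "t \<in> T" for t
    using finT that by (auto simp: m_def)
  have m_le_w: "m \<le> w x" for x
  proof -
    obtain t where "t \<in> T" using terminals by blast
    then show ?thesis using F_bounds[of t] \<epsilon>_pos by (simp add: w_def add_increasing2)
  qed
  have m_sub: "m \<le> dpp (\<lambda>_. m) x" if "x \<in> verts G" for x
  proof (cases "x \<in> T")
    case False
    then have "(\<lambda>_. m) ` nbrs x = {m}" using nbrs_nonempty[of x] that by auto
    then show ?thesis using False by (simp add: dpp_def)
  qed (simp add: dpp_def F_bounds)
  \<comment> \<open>Along an arc \<open>w\<close> grows by at most \<epsilon>, and some neighbor
    lies at least \<epsilon> lower. So both the mean of the extrema and the minimum plus \<epsilon>
    are at most \<open>w x\<close>.\<close>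
  have w_super: "dpp w x \<le> w x" if x: "x \<in> verts G" for x
  proof (cases "x \<in> T")
    case True
    then show ?thesis using F_bounds[OF True] \<epsilon>_pos by (simp add: dpp_def w_def add_increasing2)
  next
    case False
    have "Max (w ` nbrs x) \<le> w x + \<epsilon>"
    proof (rule Max.boundedI)
      fix a assume "a \<in> w ` nbrs x"
      then obtain y where y: "x \<rightarrow>\<^bsub>G\<^esub> y" "a = w y" by blast
      have "\<epsilon> * real (d y) \<le> \<epsilon> * real (Suc (d x))"
        using d_inc[OF that y(1)] \<epsilon>_pos by (intro mult_left_mono) auto
      then show "a \<le> w x + \<epsilon>" by (simp add: y w_def algebra_simps)
    qed (use nbrs_nonempty[of x] that False in auto)
    moreover have "Min (w ` nbrs x) \<le> w x - \<epsilon>"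
    proof -
      obtain y where y: "x \<rightarrow>\<^bsub>G\<^esub> y" "d y < d x" using d_dec x False by blast
      have "\<epsilon> * (real (d y) + 1) \<le> \<epsilon> * real (d x)"
        using y(2) \<epsilon>_pos by (intro mult_left_mono) auto
      then have "w y \<le> w x - \<epsilon>" by (simp add: w_def algebra_simps)
      moreover have "Min (w ` nbrs x) \<le> w y" using y(1) by simp
      ultimately show ?thesis by linarith
    qed
    ultimately show ?thesis using False by (simp add: dpp_def)
  qed
  \<comment> \<open>The bound by \<open>w\<close> is built into \<open>A\<close>, so that the
    pointwise suprema exist in the reals.\<close>
  define A where "A = {v. \<forall>x\<in>verts G. m \<le> v x \<and> v x \<le> w x \<and> v x \<le> dpp v x}"
  define u where "u x = (SUP v\<in>A. v x)" for x
  have "(\<lambda>_. m) \<in> A" using m_le_w m_sub by (simp add: A_def)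
  have A_le: "v x \<le> u x" if "v \<in> A" "x \<in> verts G" for v x
    unfolding u_def using that by (intro cSUP_upper bdd_aboveI[of _ "w x"]) (auto simp: A_def)
  have u_least: "u x \<le> c" if "\<And>v. v \<in> A \<Longrightarrow> v x \<le> c" for x c
    unfolding u_def using that \<open>(\<lambda>_. m) \<in> A\<close> by (intro cSUP_least) auto
  have m_le_u: "m \<le> u x" if "x \<in> verts G" for x
    using A_le[OF \<open>(\<lambda>_. m) \<in> A\<close> that] .
  have u_le_w: "u x \<le> w x" if "x \<in> verts G" for x
    using that by (intro u_least) (auto simp: A_def)
  have u_sub: "u x \<le> dpp u x" if x: "x \<in> verts G" for x
  proof (rule u_least)
    fix v assume v: "v \<in> A"
    then have "v x \<le> dpp v x" using x by (simp add: A_def)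
    also have "\<dots> \<le> dpp u x" using A_le[OF v] x by (rule dpp_mono)
    finally show "v x \<le> dpp u x" .
  qed
  have "dpp u \<in> A"
    unfolding A_def
  proof (intro CollectI ballI conjI)
    fix x assume x: "x \<in> verts G"
    show "m \<le> dpp u x" using m_le_u[OF x] u_sub[OF x] by linarith
    show "dpp u x \<le> w x" using dpp_mono[of u w, OF u_le_w x] w_super[OF x] by linarith
    show "dpp u x \<le> dpp (dpp u) x" using u_sub x by (rule dpp_mono)
  qed
  then show ?thesis using A_le u_sub by (intro exI[of _ u]) (auto intro: antisym)
qed

end

text \<open>A solution with choice functions for a maximizing and a minimizing neighbor. Written
  with \<open>up\<close> and \<open>down\<close>, the equation speaks about the very moves that the
  strategies make.\<close>

locale optimal_moves = totalitarian_tug_of_war G T \<epsilon> F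
  for G :: "('a, 'b) pre_digraph" and T \<epsilon> F +
  fixes u :: "'a \<Rightarrow> real" and up down :: "'a \<Rightarrow> 'a"
  assumes terminal: "\<And>x. x \<in> T \<Longrightarrow> u x = F x"
    and up: "\<And>x. x \<in> verts G - T \<Longrightarrow> x \<rightarrow>\<^bsub>G\<^esub> up x"
    and down: "\<And>x. x \<in> verts G - T \<Longrightarrow> x \<rightarrow>\<^bsub>G\<^esub> down x"
    and le_up: "\<And>x y. x \<in> verts G - T \<Longrightarrow> x \<rightarrow>\<^bsub>G\<^esub> y \<Longrightarrow> u y \<le> u (up x)"
    and down_le: "\<And>x y. x \<in> verts G - T \<Longrightarrow> x \<rightarrow>\<^bsub>G\<^esub> y \<Longrightarrow> u (down x) \<le> u y"
    and u_eq: "\<And>x. x \<in> verts G - T \<Longrightarrow> u x = max ((u (up x) + u (down x)) / 2) (u (down x) + \<epsilon>)"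

context totalitarian_tug_of_war
begin

lemma exists_optimal_moves: "\<exists>u up down. optimal_moves G T \<epsilon> F u up down"
proof -
  obtain u where u: "\<And>x. x \<in> verts G \<Longrightarrow> u x = dpp u x"
    using exists_dpp_solution by blast
  have fin: "finite (u ` nbrs x)" for x by (rule finite_imageI[OF finite_nbrs])
  have "\<exists>y z. x \<rightarrow>\<^bsub>G\<^esub> y \<and> u y = Max (u ` nbrs x) \<and> x \<rightarrow>\<^bsub>G\<^esub> z \<and> u z = Min (u ` nbrs x)"
    if x: "x \<in> verts G - T" for x
  proof -
    have ne: "u ` nbrs x \<noteq> {}" using nbrs_nonempty[OF x] by simp
    from Max_in[OF fin ne] obtain y where y: "x \<rightarrow>\<^bsub>G\<^esub> y" "u y = Max (u ` nbrs x)" by fastforce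
    from Min_in[OF fin ne] obtain z where z: "x \<rightarrow>\<^bsub>G\<^esub> z" "u z = Min (u ` nbrs x)" by fastforce
    from y z show ?thesis by blast
  qed
  then obtain up down where
    up: "\<And>x. x \<in> verts G - T \<Longrightarrow> x \<rightarrow>\<^bsub>G\<^esub> up x \<and> u (up x) = Max (u ` nbrs x)" and
    down: "\<And>x. x \<in> verts G - T \<Longrightarrow> x \<rightarrow>\<^bsub>G\<^esub> down x \<and> u (down x) = Min (u ` nbrs x)"
    by metis
  have "optimal_moves G T \<epsilon> F u up down"
  proof unfold_locales
    show "u x = F x" if "x \<in> T" for x
      using that terminals u[of x] by (auto simp: dpp_def)
    fix x assume x: "x \<in> verts G - T"
    show "x \<rightarrow>\<^bsub>G\<^esub> up x" "x \<rightarrow>\<^bsub>G\<^esub> down x" using up[OF x] down[OF x] by simp_all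
    show "u x = max ((u (up x) + u (down x)) / 2) (u (down x) + \<epsilon>)"
      using x u[of x] up[OF x] down[OF x] by (simp add: dpp_def)
    fix y assume "x \<rightarrow>\<^bsub>G\<^esub> y"
    then have y: "u y \<in> u ` nbrs x" by simp
    show "u y \<le> u (up x)" using up[OF x] Max_ge[OF fin y] by simp
    show "u (down x) \<le> u y" using down[OF x] Min_le[OF fin y] by simp
  qed
  then show ?thesis by blast
qed

end

section \<open>Optimal strategies\<close>

context optimal_moves
begin

definition lo :: real where "lo = Min (u ` verts G)"
definition hi :: real where "hi = Max (u ` verts G)"

lemma lo_le: "x \<in> verts G \<Longrightarrow> lo \<le> u x"
  by (simp add: lo_def)

lemma le_hi: "x \<in> verts G \<Longrightarrow> u x \<le> hi"
  by (simp add: hi_def)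

lemma
  assumes x: "x \<in> verts G - T"
  shows tug_le: "u (up x) + u (down x) \<le> 2 * u x" and force_le: "u (down x) + \<epsilon> \<le> u x"
proof -
  have "(u (up x) + u (down x)) / 2 \<le> u x" by (subst u_eq[OF x]) simp
  then show "u (up x) + u (down x) \<le> 2 * u x" by simp
  show "u (down x) + \<epsilon> \<le> u x" by (subst u_eq[OF x]) simp
qed

text \<open>Counts whole steps of size \<epsilon> above \<open>lo\<close>. A change of
  \<open>u\<close> by at least \<epsilon> becomes a strict change of a bounded natural number, as
  \<open>AE_ends\<close> requires.\<close>

definition level :: "'a \<Rightarrow> nat" where "level x = nat \<lfloor>(u x - lo) / \<epsilon>\<rfloor>"
definition top_level :: nat where "top_level = nat \<lfloor>(hi - lo) / \<epsilon>\<rfloor>"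

lemma level_le: "x \<in> verts G \<Longrightarrow> level x \<le> top_level"
  unfolding level_def top_level_def using \<epsilon>_pos le_hi[of x]
  by (intro nat_mono floor_mono divide_right_mono) auto

lemma level_less:
  assumes "x \<in> verts G" and "u x + \<epsilon> \<le> u y"
  shows "level x < level y"
proof -
  have "0 \<le> (u x - lo) / \<epsilon>" using lo_le[OF assms(1)] \<epsilon>_pos by simp
  moreover have "(u x - lo) / \<epsilon> + 1 \<le> (u y - lo) / \<epsilon>"
    using divide_right_mono[of "u x - lo + \<epsilon>" "u y - lo" \<epsilon>] assms(2) \<epsilon>_pos
    by (simp add: add_divide_distrib)
  then have "\<lfloor>(u x - lo) / \<epsilon>\<rfloor> + 1 \<le> \<lfloor>(u y - lo) / \<epsilon>\<rfloor>"
    by (metis floor_mono floor_add_int of_int_1)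
  ultimately show ?thesis unfolding level_def by linarith
qed

section \<open>Player II: always moving to a minimum\<close>

definition S_down :: "'a strategy_II" where "S_down h = down (position h)"

lemma S_down: "S_down \<in> strategies_II G T"
  by (auto simp: strategies_II_def S_down_def intro: down)

lemma u_II_le:
  assumes x: "x \<in> verts G"
  shows "u_II G T \<epsilon> F x \<le> ereal (u x)"
proof -
  have "V_II T \<epsilon> F S\<^sub>I S_down x \<le> ereal (u x)" if S: "S\<^sub>I \<in> strategies_I G T" for S\<^sub>I
  proof -
    define I :: "'a history \<Rightarrow> bool" where "I h \<longleftrightarrow> position h \<in> verts G" for h
    have I: "I (Start x)" "\<And>h b. I h \<Longrightarrow> I (next_history T S\<^sub>I S_down h b)"
      using next_history_in_verts[OF S S_down] x by (auto simp: I_def)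
    have down_level: "level (down y) < level y" if "y \<in> verts G - T" for y
      using force_le[OF that] adj_in_verts[OF down[OF that]] by (intro level_less)
    \<comment> \<open>The good toss is a win of Player II: then, as on a forced turn, she moves to
      \<open>down\<close>, where \<open>u\<close> is at least \<epsilon> lower by
      \<open>force_le\<close>.\<close>
    have ends: "AE \<omega> in coin_space. ends T S\<^sub>I S_down x \<omega>"
    proof (rule AE_ends[where I=I and r="\<lambda>h. level (position h)" and b=False, OF I])
      show "level (position h) \<le> top_level" if "I h" for h
        using that by (simp add: I_def level_le)
      show "level (position (next_history T S\<^sub>I S_down h False)) < level (position h)"
        if "I h" "position h \<notin> T" for h
        using that down_level[of "position h"] by (auto simp: I_def next_history_def S_down_def split: decision.split)
    qed
    \<comment> \<open>Value of the position plus the payments already collected; against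
      \<open>S_down\<close> neither option of Player I raises it in expectation.\<close>
    define f :: "'a history \<Rightarrow> real" where "f h = u (position h) + real (forced_count h) * \<epsilon>" for h
    have "ext_expectation coin_space (payoff T \<epsilon> F S\<^sub>I S_down x) \<le> ereal (f (Start x))"
    proof (rule expected_payoff_le[where I=I, OF ends I])
      show "f h = F (position h) + real (forced_count h) * \<epsilon>" if "position h \<in> T" for h
        using that by (simp add: f_def terminal)
      show "lo \<le> f h" if "I h" for h
        using that lo_le[of "position h"] \<epsilon>_pos by (simp add: f_def I_def add_increasing2)
      show "f (next_history T S\<^sub>I S_down h True) + f (next_history T S\<^sub>I S_down h False) \<le> 2 * f h"
        if "I h" and nT: "position h \<notin> T" for h
      proof -
        have h: "position h \<in> verts G - T" using that by (simp add: I_def)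
        show ?thesis
        proof (cases "S\<^sub>I h")
          case (Tug y)
          then have "position h \<rightarrow>\<^bsub>G\<^esub> y" using S h by (force simp: strategies_I_def)
          then show ?thesis
            using le_up[OF h, of y] tug_le[OF h] Tug nT
            by (simp add: next_history_def f_def S_down_def)
        next
          case Force
          then show ?thesis
            using force_le[OF h] nT by (simp add: next_history_def f_def S_down_def algebra_simps)
        qed
      qed
    qed
    then show ?thesis using ends by (simp add: V_II_def f_def)
  qed
  then have "(SUP S\<^sub>I\<in>strategies_I G T. V_II T \<epsilon> F S\<^sub>I S_down x) \<le> ereal (u x)"
    by (rule SUP_least)
  then show ?thesis unfolding u_II_def by (rule INF_lower2[OF S_down])
qed

section \<open>Player I: a budget of forced turns, then a chase to the terminal nodes\<close>

text \<open>The target shrinks \<open>u\<close> toward \<open>lo\<close> by a factor \<theta> below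
  1. This gap lets a strategy with a finite budget of forced turns, depending on \<theta>, achieve
  it.\<close>

lemma u_I_ge_interpolated:
  assumes x: "x \<in> verts G" and \<theta>: "0 \<le> \<theta>" "\<theta> < 1"
  shows "ereal (lo + \<theta> * (u x - lo)) \<le> u_I G T \<epsilon> F x"
proof -
  obtain d :: "'a \<Rightarrow> nat" where d: "\<And>x. x \<in> verts G - T \<Longrightarrow> \<exists>y. x \<rightarrow>\<^bsub>G\<^esub> y \<and> d y < d x"
    by (rule exists_distance) metis
  then have "\<forall>x\<in>verts G - T. \<exists>y. x \<rightarrow>\<^bsub>G\<^esub> y \<and> d y < d x" by blast
  from bchoice[OF this] obtain near where near: "\<And>x. x \<in> verts G - T \<Longrightarrow> x \<rightarrow>\<^bsub>G\<^esub> near x"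
    and d_near: "\<And>x. x \<in> verts G - T \<Longrightarrow> d (near x) < d x"
    by blast
  obtain K0 :: nat where K0: "\<theta> * (hi - lo) / ((1 - \<theta>) * \<epsilon>) < real K0"
    using reals_Archimedean2 by blast
  \<comment> \<open>\<open>K0\<close> makes the reserve
    \<open>(1 - \<theta>) * \<epsilon> * K\<close> cover \<open>\<theta> * (hi - lo)\<close>; the
    \<open>Suc\<close> makes \<open>K\<close> positive, so that \<open>Start x\<close> belongs to
    the first phase.\<close>
  define K where "K = Suc K0"
  have K: "\<theta> * (hi - lo) \<le> (1 - \<theta>) * \<epsilon> * real K"
  proof -
    have "\<theta> * (hi - lo) / ((1 - \<theta>) * \<epsilon>) \<le> real K" using K0 by (simp add: K_def)
    then show ?thesis using \<theta> \<epsilon>_pos by (simp add: pos_divide_le_eq mult.commute)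
  qed
  \<comment> \<open>The test says that forcing attains the maximum in \<open>u_eq\<close>. Ties go
    to forcing, so a tug in the first phase aims at a node where \<open>u\<close> is larger by more
    than \<epsilon>.\<close>
  define S :: "'a strategy_I" where "S h =
    (if forced_count h < K then
       if u (up (position h)) + u (down (position h)) \<le> 2 * (u (down (position h)) + \<epsilon>) then Force
       else Tug (up (position h))
     else Tug (near (position h)))" for h
  have S: "S \<in> strategies_I G T"
    using up near by (auto simp: strategies_I_def S_def)
  define N where "N = max top_level (Max (d ` verts G))"
  have d_le: "d y \<le> N" if "y \<in> verts G" for y
    using that by (simp add: N_def le_max_iff_disj)
  define I :: "'a history \<Rightarrow> bool" where "I h \<longleftrightarrow> position h \<in> verts G \<and> forced_count h \<le> K" for h
  \<comment> \<open>The rank within a phase: missing levels below the top in the first, distance to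
    \<open>T\<close> in the second.\<close>
  define q :: "'a history \<Rightarrow> nat" where
    "q h = (if forced_count h < K then top_level - level (position h) else d (position h))" for h
  \<comment> \<open>A lexicographic rank: since \<open>q\<close> is at most \<open>N\<close>, the
    weight \<open>Suc N\<close> makes a forced turn lower \<open>r\<close> whatever it does to
    \<open>q\<close>.\<close>
  define r :: "'a history \<Rightarrow> nat" where "r h = (K - forced_count h) * Suc N + q h" for h
  have q_le: "q h \<le> N" if "position h \<in> verts G" for h
    using d_le[OF that] by (auto simp: q_def N_def)
  txt \<open>
    The factor \<open>\<theta> < 1\<close> leaves a reserve that, by the choice of \<open>K\<close>, keeps \<open>W\<close> from decreasing at the
    \<open>K\<close>-th forced turn, where it is replaced by a lower bound of the final payoff.
  \<close>
  define W :: "'a history \<Rightarrow> real" where "W h =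
    (if forced_count h < K then lo + \<theta> * (u (position h) - lo + \<epsilon> * real (forced_count h))
     else lo + \<epsilon> * real K)" for h
  \<comment> \<open>Finished histories must carry the exact payoff, of which \<open>W\<close> is
    only a lower bound.\<close>
  define f :: "'a history \<Rightarrow> real" where "f h =
    (if position h \<in> T then F (position h) + real (forced_count h) * \<epsilon> else W h)" for h
  have W_le: "W h \<le> u (position h) + real (forced_count h) * \<epsilon>"
    if "I h" and "forced_count h < K \<or> position h \<in> T" for h
  proof (cases "forced_count h < K")
    case True
    have "0 \<le> u (position h) - lo + \<epsilon> * real (forced_count h)"
      using that lo_le[of "position h"] \<epsilon>_pos by (simp add: I_def)
    then have "\<theta> * (u (position h) - lo + \<epsilon> * real (forced_count h)) \<le> u (position h) - lo + \<epsilon> * real (forced_count h)"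
      using \<theta> by (simp add: mult_left_le_one_le)
    then show ?thesis using True by (simp add: W_def mult.commute)
  next
    case False
    then have "forced_count h = K" using that by (simp add: I_def)
    then show ?thesis using False that lo_le[of "position h"] by (simp add: W_def I_def mult.commute)
  qed
  have W_le_f: "W h \<le> f h" if "I h" for h
    using W_le[OF that] by (auto simp: f_def terminal)
  have f_le: "f h \<le> hi + \<epsilon> * real K" if "I h" for h
  proof -
    have le: "u (position h) \<le> hi" "lo \<le> hi"
      using that le_hi[of "position h"] lo_le[of "position h"] by (auto simp: I_def)
    have "real (forced_count h) * \<epsilon> \<le> \<epsilon> * real K"
      using that \<epsilon>_pos by (simp add: I_def)
    then show ?thesis
      using W_le[OF that] le by (cases "position h \<in> T"; cases "forced_count h < K") (auto simp: f_def W_def terminal)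
  qed
  have "ereal (lo + \<theta> * (u x - lo)) \<le> V_I T \<epsilon> F S S' x" if S': "S' \<in> strategies_II G T" for S'
  proof -
    let ?next = "next_history T S S'"
    have in_verts: "position (?next h b) \<in> verts G" if "position h \<in> verts G" for h b
      using next_history_in_verts[OF S S' that] .
    have count: "forced_count (?next h b) \<le> K" if "forced_count h \<le> K" for h b
      using that by (auto simp: next_history_def S_def split: decision.split)
    have I: "I (Start x)" "\<And>h b. I h \<Longrightarrow> I (?next h b)"
      using in_verts count x by (auto simp: I_def)
    \<comment> \<open>The three kinds of turn that \<open>S\<close> produces at a running node, with
      what its test says about \<open>u\<close>; \<open>y\<close> is the answer of Player
      II.\<close>
    have next_cases [consumes 1, case_names force tug chase]: thesis
      if h: "position h \<in> verts G - T"
        and force: "\<And>y. \<lbrakk>position h \<rightarrow>\<^bsub>G\<^esub> y; \<And>b. ?next h b = Move h Forced y; forced_count h < K;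
          u (position h) = u (down (position h)) + \<epsilon>\<rbrakk> \<Longrightarrow> thesis"
        and tug: "\<And>y. \<lbrakk>position h \<rightarrow>\<^bsub>G\<^esub> y; ?next h True = Move h Tug_I (up (position h));
          ?next h False = Move h Tug_II y; forced_count h < K;
          2 * u (position h) = u (up (position h)) + u (down (position h));
          u (position h) + \<epsilon> \<le> u (up (position h))\<rbrakk> \<Longrightarrow> thesis"
        and chase: "\<And>y. \<lbrakk>position h \<rightarrow>\<^bsub>G\<^esub> y; ?next h True = Move h Tug_I (near (position h));
          ?next h False = Move h Tug_II y; \<not> forced_count h < K\<rbrakk> \<Longrightarrow> thesis"
      for h thesis
    proof -
      have y: "position h \<rightarrow>\<^bsub>G\<^esub> S' h" using S' h by (simp add: strategies_II_def)
      note u = u_eq[OF h]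
      show thesis
      proof (cases "forced_count h < K")
        case True
        show thesis
        proof (cases "u (up (position h)) + u (down (position h)) \<le> 2 * (u (down (position h)) + \<epsilon>)")
          case F: True
          then have "u (position h) = u (down (position h)) + \<epsilon>" by (subst u) (simp add: max_def)
          then show thesis by (intro force[OF y]) (use h True F in \<open>auto simp: next_history_def S_def\<close>)
        next
          case F: False
          then have eq: "2 * u (position h) = u (up (position h)) + u (down (position h))"
            by (subst u) (simp add: max_def)
          have "u (position h) + \<epsilon> \<le> u (up (position h))" using eq F by argo
          with eq show thesis by (intro tug[OF y]) (use h True F in \<open>auto simp: next_history_def S_def\<close>)
        qed
      next
        case False
        then show thesis by (intro chase[OF y]) (use h in \<open>auto simp: next_history_def S_def\<close>)
      qed
    qed
    \<comment> \<open>The good toss is a win of Player I: a forced turn uses up budget, a tug raises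
      the level, and a chase shortens the distance.\<close>
    have ends: "AE \<omega> in coin_space. ends T S S' x \<omega>"
    proof (rule AE_ends[where I=I and r=r and b=True, OF I])
      show "r h \<le> K * Suc N + N" if "I h" for h
        unfolding r_def using that q_le[of h] by (intro add_mono mult_right_mono) (auto simp: I_def)
      show "r (?next h True) < r h" if "I h" "position h \<notin> T" for h
      proof -
        have h: "position h \<in> verts G - T" using that by (simp add: I_def)
        from h show ?thesis
        proof (cases rule: next_cases)
          case (force y)
          have "q (?next h True) \<le> N" using h by (intro q_le in_verts) simp
          moreover have "K - forced_count h = Suc (K - forced_count (?next h True))"
            using force by simp
          ultimately show ?thesis by (simp add: r_def)
        next
          case (tug y)
          have "level (position h) < level (up (position h))"
            using h tug by (intro level_less) auto
          moreover have "level (up (position h)) \<le> top_level"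
            using up[OF h] by (intro level_le) (blast intro: adj_in_verts)
          ultimately show ?thesis using tug by (simp add: r_def q_def)
        next
          case (chase y)
          then show ?thesis using d_near[OF h] by (simp add: r_def q_def)
        qed
      qed
    qed
    have "ereal (f (Start x)) \<le> ext_expectation coin_space (payoff T \<epsilon> F S S' x)"
    proof (rule expected_payoff_ge[where I=I, OF ends I _ f_le])
      show "f h = F (position h) + real (forced_count h) * \<epsilon>" if "position h \<in> T" for h
        using that by (simp add: f_def)
      show "2 * f h \<le> f (?next h True) + f (?next h False)" if "I h" "position h \<notin> T" for h
      proof -
        have h: "position h \<in> verts G - T" using that by (simp add: I_def)
        have "2 * W h \<le> W (?next h True) + W (?next h False)"
          using h
        proof (cases rule: next_cases)
          case (force y)
          \<comment> \<open>Wherever Player II is forced to move, \<open>u\<close> drops by at most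
            \<epsilon>, which the payment makes up for.\<close>
          have uy: "u (position h) \<le> u y + \<epsilon>" using down_le[OF h force(1)] force(4) by simp
          have "W h \<le> W (Move h Forced y)"
          proof (cases "Suc (forced_count h) < K")
            case True
            have "\<theta> * (u (position h) - lo + \<epsilon> * real (forced_count h))
                \<le> \<theta> * (u y - lo + \<epsilon> * real (Suc (forced_count h)))"
              using uy \<theta> by (intro mult_left_mono) (auto simp: algebra_simps)
            then show ?thesis using True by (simp add: W_def)
          next
            case False
            \<comment> \<open>This is the \<open>K\<close>-th forced turn: \<open>W\<close> jumps to
              its second-phase constant, which is large enough by the choice of
              \<open>K\<close>.\<close>
            have "\<theta> * (u (position h) - lo + \<epsilon> * real (forced_count h)) \<le> \<theta> * ((hi - lo) + \<epsilon> * real K)"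
              using h le_hi[of "position h"] force \<epsilon>_pos \<theta> by (intro mult_left_mono add_mono) auto
            also have "\<dots> \<le> \<epsilon> * real K" using K by (simp add: algebra_simps)
            finally show ?thesis using False force(3) by (simp add: W_def)
          qed
          then show ?thesis by (simp add: force(2))
        next
          case (tug y)
          \<comment> \<open>The move of Player II is no lower than \<open>down\<close>, so the mean
            of \<open>u\<close> over both tosses is at least \<open>u (position h)\<close>, and the
            count is unchanged.\<close>
          have "\<theta> * (2 * u (position h)) \<le> \<theta> * (u (up (position h)) + u y)"
            using \<theta> tug(5) down_le[OF h tug(1)] by (intro mult_left_mono) auto
          then show ?thesis using tug(2-4) by (simp add: W_def algebra_simps)
        next
          case (chase y)
          then show ?thesis by (simp add: W_def)
        qed
        \<comment> \<open>Replacing \<open>W\<close> by \<open>f\<close> can only raise the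
          successors, while at the running node \<open>h\<close> both agree.\<close>
        also have "\<dots> \<le> f (?next h True) + f (?next h False)"
          by (intro add_mono W_le_f I that)
        finally show ?thesis using that(2) by (simp add: f_def)
      qed
    qed
    moreover have "lo + \<theta> * (u x - lo) \<le> f (Start x)"
      using W_le_f[OF I(1)] by (simp add: W_def K_def)
    ultimately show ?thesis using ends by (auto simp: V_I_def intro: order_trans[rotated])
  qed
  then have "ereal (lo + \<theta> * (u x - lo)) \<le> (INF S'\<in>strategies_II G T. V_I T \<epsilon> F S S' x)"
    by (rule INF_greatest)
  then show ?thesis unfolding u_I_def by (rule SUP_upper2[OF S])
qed

text \<open>Let \<theta> tend to 1 along \<open>n / Suc n\<close> in the interpolated bound.\<close>

lemma u_I_ge:
  assumes "x \<in> verts G"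
  shows "ereal (u x) \<le> u_I G T \<epsilon> F x"
proof (rule LIMSEQ_le_const2)
  have "(\<lambda>n. lo + real n / real (Suc n) * (u x - lo)) \<longlonglongrightarrow> lo + 1 * (u x - lo)"
    by (intro tendsto_intros LIMSEQ_n_over_Suc_n)
  then show "(\<lambda>n. ereal (lo + real n / real (Suc n) * (u x - lo))) \<longlonglongrightarrow> ereal (u x)" by simp
  have "ereal (lo + real n / real (Suc n) * (u x - lo)) \<le> u_I G T \<epsilon> F x" for n
    by (rule u_I_ge_interpolated[OF assms]) auto
  then show "\<exists>N. \<forall>n\<ge>N. ereal (lo + real n / real (Suc n) * (u x - lo)) \<le> u_I G T \<epsilon> F x"
    by blast
qed

end

section \<open>Weak duality and the conclusion\<close>

text \<open>Sup-inf is at most inf-sup, because \<open>V_I\<close> and \<open>V_II\<close> agree on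
  almost surely ending games and are minus and plus infinity otherwise.\<close>

lemma u_I_le_u_II: "u_I G T \<epsilon> F x \<le> u_II G T \<epsilon> F x"
  unfolding u_I_def u_II_def
proof (intro SUP_least INF_greatest)
  fix S\<^sub>I S\<^sub>I\<^sub>I assume S: "S\<^sub>I \<in> strategies_I G T" "S\<^sub>I\<^sub>I \<in> strategies_II G T"
  have "(INF S\<^sub>I\<^sub>I\<in>strategies_II G T. V_I T \<epsilon> F S\<^sub>I S\<^sub>I\<^sub>I x) \<le> V_I T \<epsilon> F S\<^sub>I S\<^sub>I\<^sub>I x"
    using S(2) by (rule INF_lower)
  also have "\<dots> \<le> V_II T \<epsilon> F S\<^sub>I S\<^sub>I\<^sub>I x" by (simp add: V_I_def V_II_def)
  also have "\<dots> \<le> (SUP S\<^sub>I\<in>strategies_I G T. V_II T \<epsilon> F S\<^sub>I S\<^sub>I\<^sub>I x)"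
    using S(1) by (rule SUP_upper)
  finally show "(INF S\<^sub>I\<^sub>I\<in>strategies_II G T. V_I T \<epsilon> F S\<^sub>I S\<^sub>I\<^sub>I x) \<le> (SUP S\<^sub>I\<in>strategies_I G T. V_II T \<epsilon> F S\<^sub>I S\<^sub>I\<^sub>I x)" .
qed

theorem theorem1p3:
  fixes G :: "('a, 'b) pre_digraph"
    and T :: "'a set"
    and \<epsilon> :: real
    and F :: "'a \<Rightarrow> real"
  assumes "pseudo_graph G"
    and "T \<subseteq> verts G"
    and "T \<noteq> {}"
    and "terminals_reachable G T"
    and "\<epsilon> > 0"
  shows "\<forall>x\<in>verts G. u_I G T \<epsilon> F x = u_II G T \<epsilon> F x"
proof
  fix x assume x: "x \<in> verts G"
  interpret totalitarian_tug_of_war G T \<epsilon> F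
    using assms by (intro totalitarian_tug_of_war.intro totalitarian_tug_of_war_axioms.intro)
  obtain u up down where "optimal_moves G T \<epsilon> F u up down"
    using exists_optimal_moves by blast
  then interpret optimal_moves G T \<epsilon> F u up down .
  have "u_II G T \<epsilon> F x \<le> u_I G T \<epsilon> F x"
    using u_II_le[OF x] u_I_ge[OF x] by (rule order_trans)
  then show "u_I G T \<epsilon> F x = u_II G T \<epsilon> F x"
    by (rule antisym[OF u_I_le_u_II])
qed

end
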